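(* Let $R_0$ be a commutative associative ring (not necessarily unital), $G$ a group and $\alpha=(\{R_t\}_{t\in G},\{\alpha_t\}_{t\in G})$ a partial action of $G$ on $R_0$ such that, for each $t\in G$, the ideal $R_t$ has a set of local units. Then the partial skew group ring $R_0\rtimes_\alpha G$ is simple if and only if $R_0$ is $G$-simple and $R_0\delta_0$ is maximal commutative in $R_0\rtimes_\alpha G$.
   Context: The group $G$ is arbitrary and written multiplicatively, but its identity element is denoted by $0$. A partial action of $G$ on a ring $R_0$ is a pair $\alpha=(\{R_t\}_{t\in G},\{\alpha_t\}_{t\in G})$, where for each $t\in G$, $R_t$ is a (two-sided) ideal of $R_0$ and $\alpha_t:R_{t^{-1}}\to R_t$ is a ring isomorphism, such that: the ideal attached to the identity element of $G$ is $R_0$ (the whole ring) and the corresponding map is the identity map of $R_0$; $\alpha_t(R_{t^{-1}}\cap R_s)=R_t\cap R_{ts}$ for all $s,t\in G$; and $\alpha_t(\alpha_s(x))=\alpha_{ts}(x)$ for all $s,t\in G$ and $x\in R_{s^{-1}}\cap R_{s^{-1}t^{-1}}$. A ring $S$ has a set of local units if there is a set $E\subseteq S$ of idempotents such that for every $x\in S$ there is $e\in E$ with $ex=xe=x$. The partial skew group ring $R_0\rtimes_\alpha G$ is the set of all finite formal sums $\sum_{t\in G}a_t\delta_t$ with $a_t\in R_t$ and $\delta_t$ a symbol, with componentwise addition and multiplication determined by $(a_t\delta_t)(b_s\delta_s)=\alpha_t(\alpha_{t^{-1}}(a_t)b_s)\delta_{ts}$. (Under the local units hypothesis it is known to be associative.)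 $R_0\delta_0=\{a\delta_0:a\in R_0\}$, where $\delta_0$ is the symbol of the identity element of $G$. An ideal $I$ of $R_0$ is $G$-invariant if $\alpha_g(I\cap R_{g^{-1}})\subseteq I$ for all $g\in G$; $R_0$ is $G$-simple if $R_0$ and $\{0\}$ are its only $G$-invariant ideals. A ring $R$ is simple if $\{0\}$ and $R$ are its only two-sided ideals. A nonempty subset $S$ of a ring $R$ is maximal commutative in $R$ if $C_R(S)=S$, where $C_R(S)$ is the set of all elements of $R$ that commute with every element of $S$. *)

theory Defs
  imports "HOL-Library.Poly_Mapping"
begin

(* The group is a type of class group_add, the library's class of arbitrary groups.  This class is
   written additively but is not assumed commutative: t + s, - t and 0 stand for the product ts,
   the inverse of t and the identity element.

   R_0 is a type of class comm_ring, whose elements need not include a unit.  Other rings, such as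
   the skew group ring, are given by a carrier S and a multiplication m inside an ambient type
   of class ab_group_add; R_0 itself is then the carrier UNIV with times. *)

definition two_sided_ideal :: "'b::ab_group_add set \<Rightarrow> ('b \<Rightarrow> 'b \<Rightarrow> 'b) \<Rightarrow> 'b set \<Rightarrow> bool" where
  "two_sided_ideal S m I \<longleftrightarrow>
     I \<subseteq> S \<and> 0 \<in> I \<and> (\<forall>x\<in>I. \<forall>y\<in>I. x - y \<in> I) \<and>
     (\<forall>r\<in>S. \<forall>x\<in>I. m r x \<in> I \<and> m x r \<in> I)"

(* As in the source, S = {0} is not excluded. *)
definition simple_ring :: "'b::ab_group_add set \<Rightarrow> ('b \<Rightarrow> 'b \<Rightarrow> 'b) \<Rightarrow> bool" where
  "simple_ring S m \<longleftrightarrow> (\<forall>I. two_sided_ideal S m I \<longrightarrow> I = {0} \<or> I = S)"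

definition centralizer_in :: "'b set \<Rightarrow> ('b \<Rightarrow> 'b \<Rightarrow> 'b) \<Rightarrow> 'b set \<Rightarrow> 'b set" where
  "centralizer_in S m T = {x \<in> S. \<forall>y\<in>T. m x y = m y x}"

definition maximal_commutative :: "'b set \<Rightarrow> ('b \<Rightarrow> 'b \<Rightarrow> 'b) \<Rightarrow> 'b set \<Rightarrow> bool" where
  "maximal_commutative S m T \<longleftrightarrow> T \<noteq> {} \<and> T \<subseteq> S \<and> centralizer_in S m T = T"

definition has_local_units :: "'a::comm_ring set \<Rightarrow> bool" where
  "has_local_units S \<longleftrightarrow>
     (\<exists>E\<subseteq>S. (\<forall>e\<in>E. e * e = e) \<and> (\<forall>x\<in>S. \<exists>e\<in>E. e * x = x \<and> x * e = x))"

(* \<alpha> t is a total function of which only the restriction to R (- t) matters. *)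
definition partial_action ::
  "('g::group_add \<Rightarrow> 'a::comm_ring set) \<Rightarrow> ('g \<Rightarrow> 'a \<Rightarrow> 'a) \<Rightarrow> bool" where
  "partial_action R \<alpha> \<longleftrightarrow>
     (\<forall>t. two_sided_ideal UNIV (*) (R t)) \<and>
     (\<forall>t. bij_betw (\<alpha> t) (R (- t)) (R t) \<and>
          (\<forall>x\<in>R (- t). \<forall>y\<in>R (- t). \<alpha> t (x + y) = \<alpha> t x + \<alpha> t y \<and> \<alpha> t (x * y) = \<alpha> t x * \<alpha> t y)) \<and>
     R 0 = UNIV \<and> (\<forall>x. \<alpha> 0 x = x) \<and>
     (\<forall>s t. \<alpha> t ` (R (- t) \<inter> R s) = R t \<inter> R (t + s)) \<and>
     (\<forall>s t. \<forall>x \<in> R (- s) \<inter> R (- s + - t). \<alpha> t (\<alpha> s x) = \<alpha> (t + s) x)"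

definition G_invariant ::
  "('g::group_add \<Rightarrow> 'a::comm_ring set) \<Rightarrow> ('g \<Rightarrow> 'a \<Rightarrow> 'a) \<Rightarrow> 'a set \<Rightarrow> bool" where
  "G_invariant R \<alpha> I \<longleftrightarrow> (\<forall>g. \<alpha> g ` (I \<inter> R (- g)) \<subseteq> I)"

definition G_simple ::
  "('g::group_add \<Rightarrow> 'a::comm_ring set) \<Rightarrow> ('g \<Rightarrow> 'a \<Rightarrow> 'a) \<Rightarrow> bool" where
  "G_simple R \<alpha> \<longleftrightarrow>
     (\<forall>I. two_sided_ideal UNIV (*) I \<and> G_invariant R \<alpha> I \<longrightarrow> I = {0} \<or> I = UNIV)"

(* A finite formal sum of terms a_t \<delta>_t is the finitely supported function sending t to a_t, so
   a \<delta>_t is Poly_Mapping.single t a.  Addition is the pointwise one of the library.  The product is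
   skew_mult below, not the convolution product of the library. *)
definition skew_carrier ::
  "('g::group_add \<Rightarrow> 'a::comm_ring set) \<Rightarrow> ('g \<Rightarrow>\<^sub>0 'a) set" where
  "skew_carrier R = {f. \<forall>t. Poly_Mapping.lookup f t \<in> R t}"

(* The biadditive extension of (a \<delta>_t) (b \<delta>_s) = \<alpha> t (\<alpha> (- t) a * b) \<delta>_(t + s). *)
definition skew_mult ::
  "('g::group_add \<Rightarrow> 'a::comm_ring \<Rightarrow> 'a) \<Rightarrow> ('g \<Rightarrow>\<^sub>0 'a) \<Rightarrow> ('g \<Rightarrow>\<^sub>0 'a) \<Rightarrow> ('g \<Rightarrow>\<^sub>0 'a)" where
  "skew_mult \<alpha> f g =
     (\<Sum>t\<in>Poly_Mapping.keys f. \<Sum>s\<in>Poly_Mapping.keys g.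
        Poly_Mapping.single (t + s)
          (\<alpha> t (\<alpha> (- t) (Poly_Mapping.lookup f t) * Poly_Mapping.lookup g s)))"

definition base_copy :: "('g::group_add \<Rightarrow>\<^sub>0 'a::comm_ring) set" where
  "base_copy = range (\<lambda>a. Poly_Mapping.single 0 a)"

end

theory Submission
  imports Defs
begin

text \<open>
  Suppose first that the base is G-simple and that its copy is maximal commutative, and let \<open>I\<close>
  be a nonzero ideal of the skew group ring. Take a nonzero element of \<open>I\<close> with as few
  coefficients as possible, and move one of them to the neutral position by multiplying with a
  monomial. The commutator of the result with any base element loses that coefficient, because the
  base is commutative, and so it vanishes by minimality. The element therefore centralizes the base
  copy, hence lies in it (\<open>ideal_meets_base\<close>). The base elements whose copies lie in \<open>I\<close> now form
  a nonzero ideal, which is invariant because conjugation by monomials realizes the partial action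
  (\<open>base_part_invariant\<close>). By G-simplicity \<open>I\<close> contains the whole base copy, whose idempotents
  generate every monomial (\<open>ideal_containing_base\<close>).

  Conversely, let the skew group ring be simple. For an invariant ideal \<open>J\<close> of the base, the
  elements with all coefficients in \<open>J\<close> form an ideal; it is \<open>{0}\<close> or everything, and so is \<open>J\<close>
  (\<open>simple_imp_G_simple\<close>).

  For maximal commutativity, suppose that some element centralizing the base copy has a nonzero
  coefficient \<open>c\<close> at a group element \<open>g \<noteq> 0\<close>. Comparing coefficients shows that \<open>c\<close> does not
  distinguish \<open>\<alpha> g a\<close> from \<open>a\<close>; if the base is a ring of functions that separates points, this says that
  \<open>c\<close> lives on points fixed by \<open>g\<close>. Such elements, for all \<open>g\<close> together, give rise to the
  differences \<open>c \<delta>\<^sub>h - c \<delta>\<^sub>g\<^sub>+\<^sub>h\<close>, and the additive span of these differences is an ideal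
  (\<open>twists_ideal\<close>). It is nonzero, since it contains \<open>c \<delta>\<^sub>0 - c \<delta>\<^sub>g\<close>. It is proper, since every
  member has coefficient sum zero whereas \<open>c \<delta>\<^sub>0\<close> does not. This contradicts simplicity.
\<close>

section \<open>Partial actions by ideals with local units\<close>

locale local_unit_action =
  fixes R :: "'g::group_add \<Rightarrow> 'a::comm_ring set"
    and \<alpha> :: "'g \<Rightarrow> 'a \<Rightarrow> 'a"
  assumes action: "partial_action R \<alpha>"
    and local_units: "\<And>t. has_local_units (R t)"
begin

lemma action_parts:
  "\<forall>t. two_sided_ideal UNIV (*) (R t)"
  "\<forall>t. bij_betw (\<alpha> t) (R (- t)) (R t) \<and>
       (\<forall>x\<in>R (- t). \<forall>y\<in>R (- t). \<alpha> t (x + y) = \<alpha> t x + \<alpha> t y \<and> \<alpha> t (x * y) = \<alpha> t x * \<alpha> t y)"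
  "R 0 = UNIV"
  "\<forall>x. \<alpha> 0 x = x"
  "\<forall>s t. \<alpha> t ` (R (- t) \<inter> R s) = R t \<inter> R (t + s)"
  "\<forall>s t. \<forall>x \<in> R (- s) \<inter> R (- s + - t). \<alpha> t (\<alpha> s x) = \<alpha> (t + s) x"
  by (insert action, unfold partial_action_def, elim conjE, assumption)+

lemma R_ideal: "two_sided_ideal UNIV (*) (R t)"
  using action_parts(1) by blast

lemma R_zero [simp]: "0 \<in> R t"
  using R_ideal[of t] by (simp add: two_sided_ideal_def)

lemma R_diff: "x \<in> R t \<Longrightarrow> y \<in> R t \<Longrightarrow> x - y \<in> R t"
  using R_ideal[of t] by (simp add: two_sided_ideal_def)

lemma R_mult_right: "x \<in> R t \<Longrightarrow> x * r \<in> R t"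
  using R_ideal[of t] by (simp add: two_sided_ideal_def)

lemma R_mult_left: "x \<in> R t \<Longrightarrow> r * x \<in> R t"
  using R_mult_right[of x t r] by (simp add: mult.commute)

lemma R_neutral [simp]: "R 0 = UNIV"
  and \<alpha>_neutral [simp]: "\<alpha> 0 x = x"
  by (simp_all add: action_parts(3,4))

lemma \<alpha>_mem: "x \<in> R (- t) \<Longrightarrow> \<alpha> t x \<in> R t"
  using action_parts(2) by (meson bij_betwE)

lemma \<alpha>_uminus_mem: "x \<in> R t \<Longrightarrow> \<alpha> (- t) x \<in> R (- t)"
  using \<alpha>_mem[of x "- t"] by simp

lemma \<alpha>_add: "x \<in> R (- t) \<Longrightarrow> y \<in> R (- t) \<Longrightarrow> \<alpha> t (x + y) = \<alpha> t x + \<alpha> t y"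
  and \<alpha>_mult: "x \<in> R (- t) \<Longrightarrow> y \<in> R (- t) \<Longrightarrow> \<alpha> t (x * y) = \<alpha> t x * \<alpha> t y"
  using action_parts(2) by simp_all

lemma \<alpha>_zero [simp]: "\<alpha> t 0 = 0"
  using \<alpha>_add[of 0 t 0] by simp

lemma \<alpha>_diff: "x \<in> R (- t) \<Longrightarrow> y \<in> R (- t) \<Longrightarrow> \<alpha> t (x - y) = \<alpha> t x - \<alpha> t y"
  using \<alpha>_add[of "x - y" t y] R_diff by (simp add: eq_diff_eq)

lemma \<alpha>_uminus_mult: "x \<in> R t \<Longrightarrow> y \<in> R t \<Longrightarrow> \<alpha> (- t) (x * y) = \<alpha> (- t) x * \<alpha> (- t) y"
  using \<alpha>_mult[of x "- t" y] by simp

lemma \<alpha>_inter: "x \<in> R (- t) \<Longrightarrow> x \<in> R s \<Longrightarrow> \<alpha> t x \<in> R (t + s)"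
  using action_parts(5) by blast

lemma \<alpha>_comp: "x \<in> R (- s) \<Longrightarrow> x \<in> R (- s - t) \<Longrightarrow> \<alpha> t (\<alpha> s x) = \<alpha> (t + s) x"
  using action_parts(6) by simp

lemma \<alpha>_inverse [simp]: "x \<in> R t \<Longrightarrow> \<alpha> t (\<alpha> (- t) x) = x"
  using \<alpha>_comp[of x "- t" t] by simp

lemma \<alpha>_inverse' [simp]: "x \<in> R (- t) \<Longrightarrow> \<alpha> (- t) (\<alpha> t x) = x"
  using \<alpha>_inverse[of x "- t"] by simp

lemma unit_obtain:
  assumes "x \<in> R t"
  obtains e where "e \<in> R t" "e * e = e" "x * e = x"
  using local_units[of t] assms unfolding has_local_units_def by blast

text \<open>
  The product of local units chosen separately in three ideals lies in all three, and commutativity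
  makes it idempotent. Cutting by such a unit is how elements are brought into domains on which
  composites of the partial action are defined.
\<close>

lemma common_unit_obtain:
  assumes "x \<in> R s" "x \<in> R t" "x \<in> R u"
  obtains e where "e \<in> R s" "e \<in> R t" "e \<in> R u" "e * e = e" "x * e = x"
proof -
  obtain e1 where 1: "e1 \<in> R s" "e1 * e1 = e1" "x * e1 = x" using unit_obtain assms by blast
  obtain e2 where 2: "e2 \<in> R t" "e2 * e2 = e2" "x * e2 = x" using unit_obtain assms by blast
  obtain e3 where 3: "e3 \<in> R u" "e3 * e3 = e3" "x * e3 = x" using unit_obtain assms by blast
  have "e1 * e2 * e3 * (e1 * e2 * e3) = (e1 * e1) * (e2 * e2) * (e3 * e3)"
    by (simp add: mult_ac)
  moreover have "x * (e1 * e2 * e3) = ((x * e1) * e2) * e3" by (simp add: mult_ac)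
  ultimately show ?thesis
    using 1 2 3 by (intro that[of "e1 * e2 * e3"]) (auto intro: R_mult_left R_mult_right)
qed

lemma \<alpha>_uminus_absorb:
  assumes "c \<in> R t" "y \<in> R (- t)"
  shows "\<alpha> t (\<alpha> (- t) c * y) = c * \<alpha> t y"
  using assms by (simp add: \<alpha>_mult \<alpha>_uminus_mem)

text \<open>
  The product of monomials changes the coefficient \<open>c\<close> only by a factor from the base. Here \<open>b\<close> need
  not lie in the domain of \<open>\<alpha> t\<close>; a local unit for \<open>c\<close> first cuts it down to that domain.
\<close>

lemma transport_factor:
  assumes "c \<in> R t"
  obtains y where "\<alpha> t (\<alpha> (- t) c * b) = c * y"
proof -
  obtain e where e: "e \<in> R t" "c * e = c" using unit_obtain[OF assms] by metis
  have "\<alpha> (- t) c * b = \<alpha> (- t) c * (\<alpha> (- t) e * b)"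
    using \<alpha>_uminus_mult[OF assms e(1)] e(2) by (metis mult.assoc)
  then have "\<alpha> t (\<alpha> (- t) c * b) = c * \<alpha> t (\<alpha> (- t) e * b)"
    using assms e by (simp add: \<alpha>_uminus_absorb R_mult_right \<alpha>_uminus_mem)
  then show ?thesis by (rule that)
qed

lemma transport_mem:
  assumes "a \<in> R t" "b \<in> R s"
  shows "\<alpha> t (\<alpha> (- t) a * b) \<in> R (t + s)"
  using assms by (intro \<alpha>_inter) (auto intro: R_mult_left R_mult_right \<alpha>_uminus_mem)

section \<open>Multiplication in the partial skew group ring\<close>

abbreviation mon :: "'g \<Rightarrow> 'a \<Rightarrow> 'g \<Rightarrow>\<^sub>0 'a" where "mon \<equiv> Poly_Mapping.single"
abbreviation coeff :: "('g \<Rightarrow>\<^sub>0 'a) \<Rightarrow> 'g \<Rightarrow> 'a" where "coeff \<equiv> Poly_Mapping.lookup"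
abbreviation supp :: "('g \<Rightarrow>\<^sub>0 'a) \<Rightarrow> 'g set" where "supp \<equiv> Poly_Mapping.keys"
abbreviation smult :: "('g \<Rightarrow>\<^sub>0 'a) \<Rightarrow> ('g \<Rightarrow>\<^sub>0 'a) \<Rightarrow> 'g \<Rightarrow>\<^sub>0 'a" (infixl "\<star>" 70)
  where "f \<star> g \<equiv> skew_mult \<alpha> f g"
abbreviation SG :: "('g \<Rightarrow>\<^sub>0 'a) set" where "SG \<equiv> skew_carrier R"

lemma carrier_coeff: "f \<in> SG \<Longrightarrow> coeff f t \<in> R t"
  by (simp add: skew_carrier_def)

lemma carrier_mon [simp]: "mon t a \<in> SG \<longleftrightarrow> a \<in> R t"
  by (auto simp: skew_carrier_def lookup_single when_def)

lemma carrier_diff: "f \<in> SG \<Longrightarrow> g \<in> SG \<Longrightarrow> f - g \<in> SG"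
  by (auto simp: skew_carrier_def lookup_minus R_diff)

lemma carrier_zero [simp]: "0 \<in> SG"
  by (auto simp: skew_carrier_def)

lemma smult_superset:
  assumes "finite A" "supp f \<subseteq> A" "finite B" "supp g \<subseteq> B"
  shows "f \<star> g = (\<Sum>t\<in>A. \<Sum>s\<in>B. mon (t + s) (\<alpha> t (\<alpha> (- t) (coeff f t) * coeff g s)))"
proof -
  have "f \<star> g = (\<Sum>t\<in>supp f. \<Sum>s\<in>B. mon (t + s) (\<alpha> t (\<alpha> (- t) (coeff f t) * coeff g s)))"
    unfolding skew_mult_def
    by (intro sum.cong refl sum.mono_neutral_left assms ballI) (auto simp: in_keys_iff)
  also have "\<dots> = (\<Sum>t\<in>A. \<Sum>s\<in>B. mon (t + s) (\<alpha> t (\<alpha> (- t) (coeff f t) * coeff g s)))"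
    by (intro sum.mono_neutral_left assms ballI) (auto simp: in_keys_iff)
  finally show ?thesis .
qed

lemma mon_smult_mon: "mon t a \<star> mon s b = mon (t + s) (\<alpha> t (\<alpha> (- t) a * b))"
  by (subst smult_superset[of "{t}" _ "{s}"]) auto

lemma mon_smult:
  "mon t a \<star> g = (\<Sum>s\<in>supp g. mon (t + s) (\<alpha> t (\<alpha> (- t) a * coeff g s)))"
  by (subst smult_superset[of "{t}" _ "supp g"]) auto

lemma smult_mon:
  "f \<star> mon s b = (\<Sum>t\<in>supp f. mon (t + s) (\<alpha> t (\<alpha> (- t) (coeff f t) * b)))"
  by (subst smult_superset[of "supp f" _ "{s}"]) auto

lemma smult_eq_sum_left: "f \<star> g = (\<Sum>t\<in>supp f. mon t (coeff f t) \<star> g)"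
  by (simp add: mon_smult skew_mult_def[of \<alpha> f g])

lemma smult_eq_sum_right: "f \<star> g = (\<Sum>s\<in>supp g. f \<star> mon s (coeff g s))"
  unfolding skew_mult_def[of \<alpha> f g] smult_mon[of f] by (rule sum.swap)

lemma smult_diff_right:
  assumes "f \<in> SG" "g \<in> SG" "h \<in> SG"
  shows "f \<star> (g - h) = f \<star> g - f \<star> h"
proof -
  let ?B = "supp g \<union> supp h"
  have "\<alpha> t (\<alpha> (- t) (coeff f t) * coeff (g - h) s)
      = \<alpha> t (\<alpha> (- t) (coeff f t) * coeff g s) - \<alpha> t (\<alpha> (- t) (coeff f t) * coeff h s)" for t s
    using assms by (simp add: lookup_minus right_diff_distrib \<alpha>_diff R_mult_right
        \<alpha>_uminus_mem carrier_coeff)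
  moreover have "supp (g - h) \<subseteq> ?B" by (auto simp: in_keys_iff lookup_minus)
  ultimately show ?thesis
    by (simp add: smult_superset[of "supp f" f ?B] single_diff sum_subtractf)
qed

lemma smult_diff_left:
  assumes "f \<in> SG" "g \<in> SG" "h \<in> SG"
  shows "(f - g) \<star> h = f \<star> h - g \<star> h"
proof -
  let ?A = "supp f \<union> supp g"
  have "\<alpha> t (\<alpha> (- t) (coeff (f - g) t) * coeff h s)
      = \<alpha> t (\<alpha> (- t) (coeff f t) * coeff h s) - \<alpha> t (\<alpha> (- t) (coeff g t) * coeff h s)" for t s
    using assms by (simp add: lookup_minus \<alpha>_diff[of _ "- t"] left_diff_distrib
        \<alpha>_diff[of _ t] R_mult_right \<alpha>_uminus_mem carrier_coeff)
  moreover have "supp (f - g) \<subseteq> ?A" by (auto simp: in_keys_iff lookup_minus)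
  ultimately show ?thesis
    by (simp add: smult_superset[of ?A _ "supp h"] single_diff sum_subtractf)
qed

lemma coeff_smult_mon:
  "coeff (f \<star> mon s b) k = \<alpha> (k - s) (\<alpha> (- (k - s)) (coeff f (k - s)) * b)"
proof -
  have "coeff (f \<star> mon s b) k
      = (\<Sum>t\<in>supp f. if t = k - s then \<alpha> t (\<alpha> (- t) (coeff f t) * b) else 0)"
    unfolding smult_mon
    by (auto simp: lookup_sum lookup_single when_def eq_diff_eq intro!: sum.cong)
  also have "\<dots> = \<alpha> (k - s) (\<alpha> (- (k - s)) (coeff f (k - s)) * b)"
    by (auto simp: in_keys_iff)
  finally show ?thesis .
qed

lemma coeff_base_smult: "coeff (mon 0 a \<star> f) k = a * coeff f k"
proof -
  have "coeff (mon 0 a \<star> f) k = (\<Sum>t\<in>supp f. if t = k then a * coeff f t else 0)"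
    unfolding mon_smult
    by (auto simp: lookup_sum lookup_single when_def intro!: sum.cong)
  also have "\<dots> = a * coeff f k" by (auto simp: in_keys_iff)
  finally show ?thesis .
qed

section \<open>Ideals as additive spans\<close>

inductive_set add_span :: "('g \<Rightarrow>\<^sub>0 'a) set \<Rightarrow> ('g \<Rightarrow>\<^sub>0 'a) set" for B where
  gen: "b \<in> B \<Longrightarrow> b \<in> add_span B"
| zero: "0 \<in> add_span B"
| diff: "x \<in> add_span B \<Longrightarrow> y \<in> add_span B \<Longrightarrow> x - y \<in> add_span B"

lemma add_span_sum: "(\<And>i. i \<in> A \<Longrightarrow> f i \<in> add_span B) \<Longrightarrow> sum f A \<in> add_span B"
proof (induction A rule: infinite_finite_induct)
  case (insert i A)
  have "f i - (0 - sum f A) \<in> add_span B"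
    using insert by (intro add_span.diff add_span.zero) auto
  with insert.hyps show ?case by simp
qed (auto intro: add_span.zero)

text \<open>
  Every element of the ring is a sum of monomials, so an additive span is an ideal as soon as
  multiplying a generator by a monomial stays in the span.
\<close>

lemma add_span_ideal:
  assumes B: "B \<subseteq> SG"
    and left: "\<And>t a b. a \<in> R t \<Longrightarrow> b \<in> B \<Longrightarrow> mon t a \<star> b \<in> add_span B"
    and right: "\<And>t a b. a \<in> R t \<Longrightarrow> b \<in> B \<Longrightarrow> b \<star> mon t a \<in> add_span B"
  shows "two_sided_ideal SG (\<star>) (add_span B)"
proof -
  have car: "x \<in> SG" if "x \<in> add_span B" for x
    using that
  proof induction
    case (gen b)
    then show ?case using B by blast
  qed (simp_all add: carrier_diff)
  have "mon t a \<star> x \<in> add_span B" if "x \<in> add_span B" "a \<in> R t" for t a x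
    using that
  proof induction
    case (diff x y)
    then show ?case by (simp add: smult_diff_right car add_span.diff)
  qed (simp_all add: left mon_smult[of _ _ 0] add_span.zero)
  then have l: "r \<star> x \<in> add_span B" if "x \<in> add_span B" "r \<in> SG" for r x
    unfolding smult_eq_sum_left[of r x] by (intro add_span_sum) (simp add: that carrier_coeff)
  have "x \<star> mon t a \<in> add_span B" if "x \<in> add_span B" "a \<in> R t" for t a x
    using that
  proof induction
    case (diff x y)
    then show ?case by (simp add: smult_diff_left car add_span.diff)
  qed (simp_all add: right smult_mon[of 0] add_span.zero)
  then have r: "x \<star> r \<in> add_span B" if "x \<in> add_span B" "r \<in> SG" for r x
    unfolding smult_eq_sum_right[of x r] by (intro add_span_sum) (simp add: that carrier_coeff)
  show ?thesis
    unfolding two_sided_ideal_def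
    by (simp add: subset_iff car l r add_span.zero add_span.diff)
qed

section \<open>A simple skew group ring has a G-simple base\<close>

lemma invariant_ideal_generates:
  assumes J: "two_sided_ideal UNIV (*) J" and inv: "G_invariant R \<alpha> J"
  shows "two_sided_ideal SG (\<star>) (add_span {mon t c |t c. c \<in> J \<inter> R t})"
proof (rule add_span_ideal)
  have \<alpha>J: "\<alpha> g x \<in> J" if "x \<in> J" "x \<in> R (- g)" for g x
    using inv that unfolding G_invariant_def by blast
  have mult: "r * x \<in> J" "x * r \<in> J" if "x \<in> J" for r x
    using J that unfolding two_sided_ideal_def by auto
  fix t a b
  assume a: "a \<in> R t" and "b \<in> {mon t c |t c. c \<in> J \<inter> R t}"
  then obtain s c where b: "b = mon s c" and c: "c \<in> J" "c \<in> R s" by blast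
  have "\<alpha> t (\<alpha> (- t) a * c) \<in> J"
    using a c by (intro \<alpha>J mult R_mult_right \<alpha>_uminus_mem)
  then show "mon t a \<star> b \<in> add_span {mon t c |t c. c \<in> J \<inter> R t}"
    unfolding b mon_smult_mon using transport_mem[OF a c(2)] by (blast intro: add_span.gen)
  have "\<alpha> s (\<alpha> (- s) c * a) \<in> J"
    using a c by (intro \<alpha>J mult R_mult_right \<alpha>_uminus_mem) auto
  then show "b \<star> mon t a \<in> add_span {mon t c |t c. c \<in> J \<inter> R t}"
    unfolding b mon_smult_mon using transport_mem[OF c(2) a] by (blast intro: add_span.gen)
qed auto

lemma simple_imp_G_simple:
  assumes "simple_ring SG (\<star>)"
  shows "G_simple R \<alpha>"
  unfolding G_simple_def
proof (intro allI impI, elim conjE)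
  fix J
  assume J: "two_sided_ideal UNIV (*) J" and inv: "G_invariant R \<alpha> J"
  let ?I = "add_span {mon t c |t c. c \<in> J \<inter> R t}"
  have J0: "0 \<in> J" and Jd: "\<And>x y. x \<in> J \<Longrightarrow> y \<in> J \<Longrightarrow> x - y \<in> J"
    using J unfolding two_sided_ideal_def by auto
  have coeffJ: "coeff f k \<in> J" if "f \<in> ?I" for f k
    using that by induction (auto simp: lookup_minus J0 Jd lookup_single when_def)
  have monI: "mon 0 a \<in> ?I" if "a \<in> J" for a
    using that by (intro add_span.gen CollectI exI[of _ 0] exI[of _ a]) simp
  consider "?I = {0}" | "?I = SG"
    using invariant_ideal_generates[OF J inv] assms unfolding simple_ring_def by blast
  then show "J = {0} \<or> J = UNIV"
  proof cases
    case 1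
    then have "a = 0" if "a \<in> J" for a
      using monI[OF that] by (metis lookup_single_eq lookup_zero singletonD)
    then show ?thesis using J0 by auto
  next
    case 2
    have "a \<in> J" for a
      using coeffJ[of "mon 0 a" 0] 2 by simp
    then show ?thesis by auto
  qed
qed

section \<open>A simple skew group ring has a maximal commutative base\<close>

text \<open>
  Multiplication by a base element does not mix coefficients, so centralizing the base copy is a
  condition on each coefficient separately.
\<close>

lemma base_centralizer_iff:
  "x \<in> centralizer_in SG (\<star>) base_copy \<longleftrightarrow>
     x \<in> SG \<and> (\<forall>a t. \<alpha> t (\<alpha> (- t) (coeff x t) * a) = a * coeff x t)"
  by (auto simp: centralizer_in_def base_copy_def poly_mapping_eq_iff fun_eq_iff
      coeff_smult_mon coeff_base_smult)

text \<open>
  For a ring of functions that separates points, \<open>fixing g\<close> consists of the functions vanishing off the fixed points of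
  \<open>g\<close>. In general such a \<open>c\<close> need not itself satisfy \<open>\<alpha> g c = c\<close>: if \<open>\<alpha> g\<close> exchanges the two
  generators \<open>x\<close> and \<open>y\<close> of a unital algebra in which \<open>x\<^sup>2 = x y = y\<^sup>2 = 0\<close>, then \<open>c = x\<close> is an example.
\<close>

definition fixing :: "'g \<Rightarrow> 'a set" where
  "fixing g = {c \<in> R (- g). \<forall>a\<in>R (- g). c * \<alpha> g a = c * a}"

lemma fixingD: "c \<in> fixing g \<Longrightarrow> a \<in> R (- g) \<Longrightarrow> c * \<alpha> g a = c * a"
  and fixing_mem_uminus: "c \<in> fixing g \<Longrightarrow> c \<in> R (- g)"
  by (auto simp: fixing_def)

lemma fixing_mult: "c \<in> fixing g \<Longrightarrow> c * y \<in> fixing g"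
  by (auto simp: fixing_def R_mult_left mult.commute[of c y] mult.assoc)

text \<open>
  If \<open>e\<close> is a local unit for \<open>c\<close> in the range of \<open>\<alpha> g\<close>, then centrality turns \<open>c = c * e\<close> into
  \<open>c = c * \<alpha> (- g) e\<close>. This is why \<open>c\<close> also lies in the domain \<open>R (- g)\<close>.
\<close>

lemma central_coeff_fixing:
  assumes c: "c \<in> R g" and central: "\<And>a. \<alpha> g (\<alpha> (- g) c * a) = a * c"
  shows "c \<in> fixing g"
proof -
  have eq: "c * \<alpha> g a = c * a" if "a \<in> R (- g)" for a
    using central[of a] \<alpha>_uminus_absorb[OF c that] by (simp add: mult.commute)
  obtain e where e: "e \<in> R g" "c * e = c" using unit_obtain[OF c] by metis
  have "c = c * \<alpha> (- g) e"
    using eq[of "\<alpha> (- g) e"] e by (simp add: \<alpha>_uminus_mem)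
  then have "c \<in> R (- g)" by (metis R_mult_left \<alpha>_uminus_mem e(1))
  with eq show ?thesis by (simp add: fixing_def)
qed

text \<open>
  As \<open>c\<close> does not see the difference between a local unit and its image under \<open>\<alpha> g\<close>, it is a
  multiple of that image, and the image lies in the translated ideal. This makes both terms of
  \<open>c \<delta>\<^sub>h - c \<delta>\<^sub>g\<^sub>+\<^sub>h\<close> legitimate elements of the skew group ring.
\<close>

lemma fixing_translate:
  assumes c: "c \<in> fixing g" and h: "c \<in> R h"
  shows "c \<in> R (g + h)"
proof -
  obtain e where e: "e \<in> R h" "e \<in> R (- g)" "c * e = c"
    using common_unit_obtain[OF h h fixing_mem_uminus[OF c]] by metis
  have "c = c * \<alpha> g e" using fixingD[OF c e(2)] e(3) by simp
  then show ?thesis using \<alpha>_inter[OF e(2,1)] by (metis R_mult_left)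
qed

lemma fixing_uminus:
  assumes c: "c \<in> fixing g"
  shows "c \<in> fixing (- g)"
proof -
  have "c \<in> R g" using fixing_translate[OF c, of 0] by simp
  moreover have "c * \<alpha> (- g) a = c * a" if "a \<in> R g" for a
    using fixingD[OF c \<alpha>_uminus_mem[OF that]] that by simp
  ultimately show ?thesis by (simp add: fixing_def)
qed

text \<open>
  The analogue of the fact that \<open>u\<close> carries the fixed points of \<open>g\<close> to those of its conjugate. It
  is what makes left multiplication by a monomial at \<open>u\<close> send differences for \<open>g\<close> to differences
  for the conjugate of \<open>g\<close>.
\<close>

lemma fixing_conjugate:
  assumes c: "c \<in> fixing g" and u: "c \<in> R (- u)"
  shows "\<alpha> u c \<in> fixing (u + g - u)"
proof -
  have gu: "c \<in> R (- g - u)"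
    using fixing_translate[OF fixing_uminus[OF c] u] by simp
  obtain e where e: "e \<in> R (- u)" "e \<in> R (- g - u)" "e \<in> R (- g)" "e * e = e" "c * e = c"
    using common_unit_obtain[OF u gu fixing_mem_uminus[OF c]] by metis
  define e' where "e' = \<alpha> u e"
  have inv: "- (u + g - u) = u + (- g - u)" by (simp add: algebra_simps minus_add)
  have e': "e' \<in> R u" "e' \<in> R (u + (- g - u))" "e' * e' = e'" "\<alpha> u c * e' = \<alpha> u c"
    unfolding e'_def
    using e(1,2,4,5) u \<alpha>_mult[of e u e] \<alpha>_mult[of c u e] by (auto intro: \<alpha>_mem \<alpha>_inter)
  \<comment> \<open>The factor \<open>e'\<close> brings \<open>a\<close> into the ideals where \<open>\<alpha> (u + g - u)\<close> splits as
    \<open>\<alpha> u\<close> after \<open>\<alpha> g\<close> after \<open>\<alpha> (- u)\<close>; applying the claim to \<open>e'\<close> itself removes it again.\<close>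
  have fixed: "\<alpha> u c * \<alpha> (u + g - u) (e' * a) = \<alpha> u c * a" for a
  proof -
    let ?w = "e' * a"
    define b where "b = \<alpha> (- u) ?w"
    have w: "?w \<in> R u" "?w \<in> R (u + (- g - u))" using e' by (auto intro: R_mult_right)
    have "b = \<alpha> (- u) (e' * ?w)" unfolding b_def using e'(3) by (simp flip: mult.assoc)
    also have "\<dots> = e * b"
      using \<alpha>_uminus_mult[OF e'(1) w(1)] e(1) by (simp add: b_def e'_def)
    finally have b: "b \<in> R (- u)" "b \<in> R (- g - u)" "b \<in> R (- g)"
      using e(1-3) by (metis R_mult_right)+
    have ub: "\<alpha> u b = ?w" using w(1) by (simp add: b_def)
    have gb: "\<alpha> g b \<in> R (- u)"
      using \<alpha>_inter[OF b(3,2)]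
      by (simp add: add.assoc[symmetric] diff_conv_add_uminus del: add_uminus_conv_diff)
    have "\<alpha> u c * a = \<alpha> u c * ?w" using e'(4) by (simp flip: mult.assoc)
    also have "\<dots> = \<alpha> u (c * b)" using u b(1) by (simp add: \<alpha>_mult ub)
    also have "\<dots> = \<alpha> u (c * \<alpha> g b)" using fixingD[OF c b(3)] by simp
    also have "\<dots> = \<alpha> u c * \<alpha> u (\<alpha> g b)" using u gb by (simp add: \<alpha>_mult)
    also have "\<alpha> u (\<alpha> g b) = \<alpha> (u + g) (\<alpha> (- u) ?w)"
      using \<alpha>_comp[OF b(3,2)] by (simp add: b_def)
    also have "\<dots> = \<alpha> (u + g - u) ?w"
      using \<alpha>_comp[of ?w "- u" "u + g"] w
      by (simp add: diff_conv_add_uminus minus_add add.assoc del: add_uminus_conv_diff)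
    finally show ?thesis by simp
  qed
  have "\<alpha> u c * \<alpha> (u + g - u) a = \<alpha> u c * a" if a: "a \<in> R (- (u + g - u))" for a
  proof -
    have "\<alpha> u c * \<alpha> (u + g - u) e' = \<alpha> u c"
      using fixed[of e'] e'(3,4) by simp
    then have "\<alpha> u c * \<alpha> (u + g - u) a = \<alpha> u c * \<alpha> (u + g - u) (e' * a)"
      using \<alpha>_mult[OF _ a, of e'] e'(2) inv by (simp flip: mult.assoc)
    then show ?thesis using fixed by simp
  qed
  moreover have "\<alpha> u c \<in> R (- (u + g - u))"
    unfolding inv by (rule \<alpha>_inter[OF u gu])
  ultimately show ?thesis by (simp add: fixing_def)
qed

text \<open>
  If all composites were defined, both sides would be \<open>c\<close> times an image of \<open>b\<close>, under \<open>\<alpha> (g + h)\<close>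
  and \<open>\<alpha> h\<close> respectively, and \<open>c\<close> does not see the extra \<open>\<alpha> g\<close>. Consequently right multiplication
  acts alike on the two terms of \<open>c \<delta>\<^sub>h - c \<delta>\<^sub>g\<^sub>+\<^sub>h\<close>.
\<close>

lemma transport_fixing:
  assumes c: "c \<in> fixing g" and h: "c \<in> R h"
  shows "\<alpha> (g + h) (\<alpha> (- (g + h)) c * b) = \<alpha> h (\<alpha> (- h) c * b)"
proof -
  obtain e where e: "e \<in> R h" "e \<in> R (- g)" "c * e = c"
    using common_unit_obtain[OF h h fixing_mem_uminus[OF c]] by metis
  define k where "k = g + h"
  have k: "c \<in> R k" unfolding k_def by (rule fixing_translate[OF c h])
  have mk: "- k = - h - g" by (simp add: k_def minus_add)
  \<comment> \<open>Multiplying \<open>b\<close> by \<open>e'\<close> changes neither side, and puts \<open>b\<close> where \<open>\<alpha> k\<close> is \<open>\<alpha> g\<close> after \<open>\<alpha> h\<close>.\<close>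
  define e' where "e' = \<alpha> (- h) e"
  have e': "e' \<in> R (- h)" "e' \<in> R (- k)" "\<alpha> h e' = e"
    using e \<alpha>_inter[of e "- h" "- g"] by (auto simp: e'_def mk \<alpha>_uminus_mem)
  have "c = c * \<alpha> g e" using fixingD[OF c e(2)] e(3) by simp
  also have "\<alpha> g e = \<alpha> k e'"
    using \<alpha>_comp[of e' h g] e' by (simp add: k_def mk[unfolded k_def])
  finally have "\<alpha> (- k) c = \<alpha> (- k) c * e'"
    using \<alpha>_uminus_mult[OF k \<alpha>_mem[OF e'(2)]] e'(2) by simp
  then have "\<alpha> k (\<alpha> (- k) c * b) = \<alpha> k (\<alpha> (- k) c * (e' * b))"
    by (metis mult.assoc)
  also have "\<dots> = c * \<alpha> k (e' * b)"
    using e'(2) k by (simp add: \<alpha>_uminus_absorb R_mult_right)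
  also have "\<alpha> k (e' * b) = \<alpha> g (\<alpha> h (e' * b))"
    using \<alpha>_comp[of "e' * b" h g] e' by (simp add: k_def mk[unfolded k_def] R_mult_right)
  also have "c * \<alpha> g (\<alpha> h (e' * b)) = c * \<alpha> h (e' * b)"
  proof (rule fixingD[OF c])
    have "\<alpha> h (e' * b) \<in> R (h + - k)"
      using e' by (intro \<alpha>_inter R_mult_right)
    then show "\<alpha> h (e' * b) \<in> R (- g)"
      by (simp add: mk diff_conv_add_uminus add.assoc[symmetric] del: add_uminus_conv_diff)
  qed
  also have "\<dots> = \<alpha> h (\<alpha> (- h) c * (e' * b))"
    using e'(1) h by (simp add: \<alpha>_uminus_absorb R_mult_right)
  also have "\<dots> = \<alpha> h (\<alpha> (- h) c * b)"
    using \<alpha>_uminus_mult[OF h e(1)] e(3) by (metis e'_def mult.assoc)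
  finally show ?thesis unfolding k_def .
qed

definition twists :: "('g \<Rightarrow>\<^sub>0 'a) set" where
  "twists = {mon h c - mon (g + h) c |g h c. c \<in> fixing g \<inter> R h}"

lemma twistsI: "c \<in> fixing g \<Longrightarrow> c \<in> R h \<Longrightarrow> mon h c - mon (g + h) c \<in> twists"
  unfolding twists_def by blast

lemma twists_carrier: "twists \<subseteq> SG"
  by (auto simp: twists_def intro!: carrier_diff fixing_translate)

text \<open>
  Left multiplication replaces \<open>g\<close> by a conjugate and right multiplication keeps \<open>g\<close>. The generating
  set therefore has to range over all \<open>g\<close>, even though a single central coefficient at a single
  group element starts the argument.
\<close>

lemma twists_ideal: "two_sided_ideal SG (\<star>) (add_span twists)"
proof (rule add_span_ideal[OF twists_carrier])
  fix u a x
  assume a: "a \<in> R u" and "x \<in> twists"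
  then obtain g h c where x: "x = mon h c - mon (g + h) c"
    and c: "c \<in> fixing g" "c \<in> R h" unfolding twists_def by blast
  have c': "c \<in> R (g + h)" by (rule fixing_translate[OF c])
  let ?d = "\<alpha> u (\<alpha> (- u) a * c)"
  have "?d \<in> fixing (u + g - u)"
  proof (rule fixing_conjugate)
    show "\<alpha> (- u) a * c \<in> fixing g"
      using fixing_mult[OF c(1), of "\<alpha> (- u) a"] by (simp add: mult.commute)
    show "\<alpha> (- u) a * c \<in> R (- u)"
      using a by (intro R_mult_right \<alpha>_uminus_mem)
  qed
  then have "mon (u + h) ?d - mon (u + g - u + (u + h)) ?d \<in> twists"
    by (rule twistsI) (rule transport_mem[OF a c(2)])
  moreover have "u + g - u + (u + h) = u + (g + h)"
    by (simp add: add.assoc[symmetric])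
  moreover have "mon u a \<star> x = mon (u + h) ?d - mon (u + (g + h)) ?d"
    unfolding x using a c c' by (simp add: smult_diff_right mon_smult_mon)
  ultimately show "mon u a \<star> x \<in> add_span twists"
    by (simp add: add_span.gen)
  let ?d = "\<alpha> h (\<alpha> (- h) c * a)"
  have "?d \<in> fixing g"
    using transport_factor[OF c(2)] fixing_mult[OF c(1)] by metis
  then have "mon (h + u) ?d - mon (g + (h + u)) ?d \<in> twists"
    by (rule twistsI) (rule transport_mem[OF c(2) a])
  moreover have "x \<star> mon u a = mon (h + u) ?d - mon (g + (h + u)) ?d"
    unfolding x using a c c'
    by (simp add: smult_diff_left mon_smult_mon transport_fixing add.assoc)
  ultimately show "x \<star> mon u a \<in> add_span twists"
    by (simp add: add_span.gen)
qed

text \<open>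
  Although it is additive, the coefficient sum is in general not multiplicative for the skew
  product. That the twists span an ideal on which it vanishes therefore has to be seen on the
  generators.
\<close>

definition augmentation :: "('g \<Rightarrow>\<^sub>0 'a) \<Rightarrow> 'a" where
  "augmentation f = (\<Sum>t\<in>supp f. coeff f t)"

lemma augmentation_superset:
  "finite A \<Longrightarrow> supp f \<subseteq> A \<Longrightarrow> augmentation f = (\<Sum>t\<in>A. coeff f t)"
  unfolding augmentation_def by (intro sum.mono_neutral_left) (auto simp: in_keys_iff)

lemma augmentation_mon [simp]: "augmentation (mon t a) = a"
  by (subst augmentation_superset[of "{t}"]) auto

lemma augmentation_diff: "augmentation (f - g) = augmentation f - augmentation g"
proof -
  have "supp (f - g) \<subseteq> supp f \<union> supp g" by (auto simp: in_keys_iff lookup_minus)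
  then show ?thesis
    by (simp add: augmentation_superset[of "supp f \<union> supp g"] lookup_minus sum_subtractf)
qed

lemma augmentation_twists: "f \<in> add_span twists \<Longrightarrow> augmentation f = 0"
  by (induction rule: add_span.induct)
     (auto simp: twists_def augmentation_diff augmentation_def[of 0])

lemma base_copy_commutative: "base_copy \<subseteq> centralizer_in SG (\<star>) base_copy"
  by (auto simp: base_copy_def centralizer_in_def mon_smult_mon mult.commute)

lemma simple_imp_maximal_commutative:
  assumes simple: "simple_ring SG (\<star>)"
  shows "maximal_commutative SG (\<star>) base_copy"
proof -
  have "x \<in> base_copy" if x: "x \<in> centralizer_in SG (\<star>) base_copy" for x
  proof (rule ccontr)
    assume nb: "x \<notin> base_copy"
    have "\<exists>g. g \<noteq> 0 \<and> coeff x g \<noteq> 0"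
    proof (rule ccontr)
      assume "\<not> ?thesis"
      then have "x = mon 0 (coeff x 0)"
        by (auto simp: poly_mapping_eq_iff fun_eq_iff lookup_single when_def)
      with nb show False unfolding base_copy_def by blast
    qed
    then obtain g where g: "g \<noteq> 0" "coeff x g \<noteq> 0" by blast
    define c where "c = coeff x g"
    have "c \<in> fixing g"
      using x unfolding c_def base_centralizer_iff
      by (intro central_coeff_fixing) (auto simp: carrier_coeff)
    then have mem: "mon 0 c - mon g c \<in> add_span twists"
      using twistsI[of c g 0] by (simp add: add_span.gen)
    have "coeff (mon 0 c - mon g c) g \<noteq> 0"
      using g by (simp add: lookup_minus lookup_single c_def)
    then have "mon 0 c - mon g c \<noteq> 0" by auto
    then have "add_span twists = SG"
      using simple twists_ideal mem unfolding simple_ring_def by blast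
    then have "augmentation (mon 0 c) = 0"
      by (intro augmentation_twists) simp
    with g show False by (simp add: c_def)
  qed
  with base_copy_commutative show ?thesis
    unfolding maximal_commutative_def by (auto simp: base_copy_def centralizer_in_def)
qed

section \<open>Simplicity from G-simplicity and maximal commutativity\<close>

text \<open>
  A nonzero element of minimal support, shifted so that its coefficient at \<open>0\<close> is nonzero, must
  centralize the base copy, as its commutators with base elements have smaller support.
\<close>

lemma ideal_meets_base:
  assumes max: "centralizer_in SG (\<star>) base_copy = base_copy"
    and I: "two_sided_ideal SG (\<star>) I" "I \<noteq> {0}"
  obtains a where "a \<noteq> 0" "mon 0 a \<in> I"
proof -
  have sub: "I \<subseteq> SG" and Id: "\<And>x y. x \<in> I \<Longrightarrow> y \<in> I \<Longrightarrow> x - y \<in> I"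
    and Il: "\<And>r x. r \<in> SG \<Longrightarrow> x \<in> I \<Longrightarrow> r \<star> x \<in> I"
    and Ir: "\<And>r x. r \<in> SG \<Longrightarrow> x \<in> I \<Longrightarrow> x \<star> r \<in> I"
    using I(1) unfolding two_sided_ideal_def by auto
  have "\<exists>x. x \<in> I \<and> x \<noteq> 0" using I unfolding two_sided_ideal_def by auto
  then obtain x where x: "x \<in> I" "x \<noteq> 0"
    and min: "\<And>y. y \<in> I \<Longrightarrow> y \<noteq> 0 \<Longrightarrow> card (supp x) \<le> card (supp y)"
    using ex_has_least_nat[of "\<lambda>x. x \<in> I \<and> x \<noteq> 0" _ "\<lambda>x. card (supp x)"] by blast
  obtain t where t: "coeff x t \<noteq> 0" using x(2) by (metis lookup_zero poly_mapping_eqI)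
  have xt: "coeff x t \<in> R t" using x sub carrier_coeff by blast
  obtain e where e: "e \<in> R (- t)" "\<alpha> (- t) (coeff x t) * e = \<alpha> (- t) (coeff x t)"
    using unit_obtain[OF \<alpha>_uminus_mem[OF xt]] by metis
  \<comment> \<open>The shift moves the coefficient at \<open>t\<close> to \<open>0\<close>; the local unit keeps it intact.\<close>
  define y where "y = x \<star> mon (- t) e"
  have yI: "y \<in> I" unfolding y_def using e x by (intro Ir) auto
  have y0: "coeff y 0 \<noteq> 0" using t xt e by (simp add: y_def coeff_smult_mon)
  have "supp y \<subseteq> (\<lambda>s. s - t) ` supp x"
  proof
    fix k assume "k \<in> supp y"
    then have "k + t \<in> supp x" by (auto simp: y_def in_keys_iff coeff_smult_mon)
    then show "k \<in> (\<lambda>s. s - t) ` supp x" by (metis add_diff_cancel image_eqI)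
  qed
  then have card_y: "card (supp y) \<le> card (supp x)"
    by (meson card_image_le card_mono finite_imageI finite_keys order_trans)
  have comm: "mon 0 a \<star> y = y \<star> mon 0 a" for a
  proof (rule ccontr)
    define z where "z = mon 0 a \<star> y - y \<star> mon 0 a"
    assume "mon 0 a \<star> y \<noteq> y \<star> mon 0 a"
    then have "z \<noteq> 0" by (simp add: z_def)
    moreover have "z \<in> I" unfolding z_def using yI by (intro Id Il Ir) auto
    moreover have "supp z \<subset> supp y"
    proof (rule psubsetI)
      show "supp z \<subseteq> supp y"
        by (auto simp: z_def in_keys_iff lookup_minus coeff_base_smult coeff_smult_mon)
      have "coeff z 0 = 0"
        by (simp add: z_def lookup_minus coeff_base_smult coeff_smult_mon mult.commute)
      with y0 show "supp z \<noteq> supp y" by (metis in_keys_iff)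
    qed
    then have "card (supp z) < card (supp y)" by (simp add: psubset_card_mono)
    ultimately show False using min[of z] card_y by simp
  qed
  then have "y \<in> centralizer_in SG (\<star>) base_copy"
    using yI sub by (auto simp: centralizer_in_def base_copy_def)
  then obtain b where "y = mon 0 b" using max unfolding base_copy_def by blast
  with y0 yI that show ?thesis by auto
qed

text \<open>
  If \<open>e\<close> is a local unit for \<open>a\<close>, then multiplying \<open>a \<delta>\<^sub>0\<close> by the monomials with coefficients
  \<open>\<alpha> g e\<close> at \<open>g\<close> on the left and \<open>e\<close> at \<open>- g\<close> on the right yields \<open>\<alpha> g a \<delta>\<^sub>0\<close>.
\<close>

lemma base_part_invariant:
  assumes I: "two_sided_ideal SG (\<star>) I"
  shows "two_sided_ideal UNIV (*) {a. mon 0 a \<in> I}" "G_invariant R \<alpha> {a. mon 0 a \<in> I}"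
proof -
  have Il: "r \<star> x \<in> I" and Ir: "x \<star> r \<in> I" if "r \<in> SG" "x \<in> I" for r x
    using I that unfolding two_sided_ideal_def by auto
  have I0: "0 \<in> I" and Id: "\<And>x y. x \<in> I \<Longrightarrow> y \<in> I \<Longrightarrow> x - y \<in> I"
    using I unfolding two_sided_ideal_def by auto
  have "mon 0 (r * x) \<in> I" "mon 0 (x * r) \<in> I" if "mon 0 x \<in> I" for r x
    using Il[of "mon 0 r" "mon 0 x"] Ir[of "mon 0 r" "mon 0 x"] that
    by (simp_all add: mon_smult_mon)
  then show "two_sided_ideal UNIV (*) {a. mon 0 a \<in> I}"
    by (simp add: two_sided_ideal_def single_diff I0 Id)
  have "mon 0 (\<alpha> g a) \<in> I" if a: "mon 0 a \<in> I" "a \<in> R (- g)" for g a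
  proof -
    obtain e where e: "e \<in> R (- g)" "a * e = a" using unit_obtain[OF a(2)] by metis
    have "mon g (\<alpha> g e) \<star> mon 0 a \<star> mon (- g) e = mon 0 (\<alpha> g a)"
      using e a by (simp add: mon_smult_mon mult.commute[of e])
    moreover have "mon g (\<alpha> g e) \<star> mon 0 a \<star> mon (- g) e \<in> I"
      using e a by (intro Il Ir) (auto intro: \<alpha>_mem)
    ultimately show ?thesis by simp
  qed
  then show "G_invariant R \<alpha> {a. mon 0 a \<in> I}"
    by (auto simp: G_invariant_def)
qed

lemma ideal_containing_base:
  assumes I: "two_sided_ideal SG (\<star>) I" and base: "\<And>a. mon 0 a \<in> I"
  shows "I = SG"
proof
  show "I \<subseteq> SG" using I unfolding two_sided_ideal_def by blast
  have I0: "0 \<in> I" and Id: "\<And>x y. x \<in> I \<Longrightarrow> y \<in> I \<Longrightarrow> x - y \<in> I"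
    using I unfolding two_sided_ideal_def by auto
  have mon: "mon t a \<in> I" if a: "a \<in> R t" for t a
  proof -
    obtain e where e: "a * e = a" using unit_obtain[OF a] by metis
    have "mon 0 e \<star> mon t a \<in> I"
      using I base[of e] a unfolding two_sided_ideal_def by (metis carrier_mon)
    moreover have "mon 0 e \<star> mon t a = mon t a"
      using e by (simp add: mon_smult_mon mult.commute[of e])
    ultimately show ?thesis by simp
  qed
  have "add_span I \<subseteq> I"
  proof
    fix x assume "x \<in> add_span I" then show "x \<in> I" by induction (auto simp: I0 Id)
  qed
  moreover have "f \<in> add_span I" if "f \<in> SG" for f
  proof -
    have "(\<Sum>t\<in>supp f. mon t (coeff f t)) = f"
      by (rule poly_mapping_eqI) (auto simp: lookup_sum lookup_single when_def in_keys_iff)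
    moreover have "(\<Sum>t\<in>supp f. mon t (coeff f t)) \<in> add_span I"
      using that by (intro add_span_sum add_span.gen mon carrier_coeff)
    ultimately show ?thesis by simp
  qed
  ultimately show "SG \<subseteq> I" by blast
qed

lemma simple_ringI:
  assumes "G_simple R \<alpha>" "maximal_commutative SG (\<star>) base_copy"
  shows "simple_ring SG (\<star>)"
  unfolding simple_ring_def
proof (intro allI impI)
  fix I
  assume I: "two_sided_ideal SG (\<star>) I"
  let ?J = "{a. mon 0 a \<in> I}"
  show "I = {0} \<or> I = SG"
  proof (cases "I = {0}")
    case False
    have max: "centralizer_in SG (\<star>) base_copy = base_copy"
      using assms(2) by (simp add: maximal_commutative_def)
    obtain a where "a \<noteq> 0" "a \<in> ?J"
      using ideal_meets_base[OF max I False] by (metis mem_Collect_eq)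
    then have "?J \<noteq> {0}" by (metis singletonD)
    moreover have "?J = {0} \<or> ?J = UNIV"
      using assms(1)[unfolded G_simple_def, rule_format, OF conjI[OF base_part_invariant[OF I]]] .
    ultimately have "mon 0 a \<in> I" for a by auto
    then show ?thesis using ideal_containing_base[OF I] by metis
  qed simp
qed

end

theorem theorem2p3:
  fixes R :: "'g::group_add \<Rightarrow> 'a::comm_ring set"
    and \<alpha> :: "'g \<Rightarrow> 'a \<Rightarrow> 'a"
  assumes "partial_action R \<alpha>"
    and "\<And>t. has_local_units (R t)"
  shows "simple_ring (skew_carrier R) (skew_mult \<alpha>) \<longleftrightarrow>
         G_simple R \<alpha> \<and> maximal_commutative (skew_carrier R) (skew_mult \<alpha>) base_copy"
proof -
  interpret local_unit_action R \<alpha> using assms by unfold_locales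
  show ?thesis
    using simple_imp_G_simple simple_imp_maximal_commutative simple_ringI by blast
qed

end
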